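(* Let $\lambda\vdash n$. A tableau $Q\in\operatorname{SYT}(\lambda)$ is admissible if and only if for all $P\in\operatorname{SYT}(\lambda)$ we have $$P=\sigma\cdot Q^\uparrow,\qquad\text{where }\sigma:=\operatorname{RS}^{-1}(P,Q).$$
   Context: $\operatorname{SYT}(\lambda)$ is the set of standard Young tableaux of shape $\lambda$ (English convention: rows left-justified, listed from top to bottom; entries $1,\ldots,n$ increasing along rows and down columns). $\operatorname{RS}:S_n\to\coprod_{\lambda\vdash n}\operatorname{SYT}(\lambda)\times\operatorname{SYT}(\lambda)$ is the Robinson--Schensted bijection, $\operatorname{RS}(\sigma)=(P,Q)$ with $P$ the insertion tableau obtained by row-inserting $\sigma_1,\ldots,\sigma_n$ and $Q$ the recording tableau. For a standard tableau $Q$, $Q^\uparrow$ is the filling of the same diagram obtained by reversing the order of the entries in each column of $Q$ (so columns of $Q^\uparrow$ decrease from top to bottom). $Q$ is called admissible if the entries of $Q^\uparrow$ increase from left to right along each row. For a filling $T$ of a diagram by $1,\ldots,n$ (not necessarily standard) and $\sigma\in S_n$, $\sigma\cdot T$ is the filling obtained by replacing each entry $i$ by $\sigma_i=\sigma(i)$. *)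

theory Defs
  imports Main "HOL-Combinatorics.Permutations"
begin

definition partitions :: "nat \<Rightarrow> nat list set" where
  "partitions n = {\<mu>. sorted_wrt (\<ge>) \<mu> \<and> 0 \<notin> set \<mu> \<and> sum_list \<mu> = n}"

(* A filling of a diagram is the list of its rows, from top to bottom. Since rows are
   left-justified of weakly decreasing length, \<open>List.transpose\<close> gives the list of its columns,
   from left to right. *)
type_synonym filling = "nat list list"

definition SYT :: "nat list \<Rightarrow> filling set" where
  "SYT \<mu> = {T. map length T = \<mu>
      \<and> distinct (concat T) \<and> set (concat T) = {1..sum_list \<mu>}
      \<and> (\<forall>r\<in>set T. sorted_wrt (<) r)
      \<and> (\<forall>c\<in>set (List.transpose T). sorted_wrt (<) c)}"

(* Insert x into a row: x replaces the leftmost entry larger than x, which is returned as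
   the bumped entry; if there is none, x is appended and nothing is bumped. *)
fun bump :: "nat \<Rightarrow> nat list \<Rightarrow> nat list \<times> nat option" where
  "bump x [] = ([x], None)"
| "bump x (y # ys) =
    (if x < y then (x # ys, Some y) else (let (r, b) = bump x ys in (y # r, b)))"

(* The second component is the index (from 0) of the row that received the new cell. *)
fun row_insert :: "nat \<Rightarrow> filling \<Rightarrow> filling \<times> nat" where
  "row_insert x [] = ([[x]], 0)"
| "row_insert x (r # rs) =
    (case bump x r of
       (r', None) \<Rightarrow> (r' # rs, 0)
     | (r', Some y) \<Rightarrow> (let (T, k) = row_insert y rs in (r' # T, Suc k)))"

definition add_cell :: "nat \<Rightarrow> nat \<Rightarrow> filling \<Rightarrow> filling" where
  "add_cell k m Q = (if k < length Q then Q[k := Q ! k @ [m]] else Q @ [[m]])"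

(* \<open>RS n \<sigma>\<close> is the pair (insertion tableau, recording tableau) of the word
   \<open>\<sigma> 1, \<dots>, \<sigma> n\<close>. *)
primrec RS :: "nat \<Rightarrow> (nat \<Rightarrow> nat) \<Rightarrow> filling \<times> filling" where
  "RS 0 \<sigma> = ([], [])"
| "RS (Suc n) \<sigma> =
    (let (P, Q) = RS n \<sigma>; (P', k) = row_insert (\<sigma> (Suc n)) P
     in (P', add_cell k (Suc n) Q))"

definition RS_inv :: "nat \<Rightarrow> filling \<times> filling \<Rightarrow> (nat \<Rightarrow> nat)" where
  "RS_inv n = inv_into {\<sigma>. \<sigma> permutes {1..n}} (RS n)"

definition reverse_columns :: "filling \<Rightarrow> filling" where
  "reverse_columns Q = List.transpose (map rev (List.transpose Q))"

definition admissible :: "filling \<Rightarrow> bool" where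
  "admissible Q \<longleftrightarrow> (\<forall>r\<in>set (reverse_columns Q). sorted_wrt (<) r)"

definition perm_act :: "(nat \<Rightarrow> nat) \<Rightarrow> filling \<Rightarrow> filling" where
  "perm_act \<sigma> T = map (map \<sigma>) T"

end

theory Submission imports Defs begin

text \<open>
  Write \<open>Q'\<close> for \<open>reverse_columns Q\<close>. The equation \<open>P = \<sigma> \<cdot> Q'\<close> says that the word \<open>\<sigma>\<close> is read off from
  \<open>P\<close>: the columns of \<open>P\<close> are inserted from bottom to top, interleaved in the order prescribed by \<open>Q\<close>.

  Suppose that \<open>Q\<close> is admissible. For any \<open>P\<close>, define \<open>\<sigma>\<close> by this equation and insert it. Step \<open>m + 1\<close>,
  where \<open>m + 1\<close> is in column \<open>j\<close> of \<open>Q\<close>, inserts the lowest entry of column \<open>j\<close> of \<open>P\<close> that has not been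
  inserted yet. Admissibility implies that at that moment each column to the left has fewer entries missing than
  column \<open>j\<close> (\<open>late_less\<close>). Hence, in the current tableau, the entries to the left of column \<open>j\<close> are smaller
  than the entry about to be placed in their row, and the insertion pushes column \<open>j\<close> straight down
  (\<open>row_insert_fill\<close>). Each column is thus rebuilt separately, the result is \<open>RS n \<sigma> = (P, Q)\<close>
  (\<open>RS_admissible\<close>), and injectivity of \<open>RS\<close> (\<open>RS_inject\<close>) shows that \<open>\<sigma>\<close> agrees on \<open>{1..n}\<close> with the
  inverse image of \<open>(P, Q)\<close>.

  Conversely, take for \<open>P\<close> the row superstandard tableau, in which horizontal neighbours are consecutive numbers
  \<open>v\<close> and \<open>v + 1\<close>. If \<open>v + 1\<close> stood before \<open>v\<close> in the word \<open>\<sigma>\<close>, insertion would keep \<open>v + 1\<close> strictly below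
  \<open>v\<close> (\<open>RS_succ_below\<close>). So \<open>v\<close> stands before \<open>v + 1\<close>, and by \<open>P = \<sigma> \<cdot> Q'\<close> their positions in the word are
  the corresponding horizontal neighbours in \<open>Q'\<close>, which therefore increase. Here it has to be known that
  \<open>(P, Q)\<close> comes from some permutation at all, which is the surjectivity of \<open>RS\<close>, proved by reverse insertion
  (\<open>RS_surj\<close>).
\<close>

section \<open>Tableaux as lists of rows\<close>

text \<open>
  Demanding this of every pair of rows of a filling says both that the row lengths decrease weakly
  and that the columns increase strictly.
\<close>

definition above :: "nat list \<Rightarrow> nat list \<Rightarrow> bool" where
  "above r s \<longleftrightarrow> length s \<le> length r \<and> (\<forall>i<length s. r ! i < s ! i)"

text \<open>
  Empty rows at the bottom are tolerated: undoing an insertion that created a new row leaves one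
  behind, and allowing it keeps the induction in \<open>uninsert\<close> free of special cases.
\<close>

definition tableau :: "filling \<Rightarrow> bool" where
  "tableau T \<longleftrightarrow> (\<forall>r\<in>set T. sorted_wrt (<) r) \<and> sorted_wrt above T"

lemma above_trans: "above r s \<Longrightarrow> above s t \<Longrightarrow> above r t"
  unfolding above_def by (meson le_trans less_le_trans less_trans)

lemma transp_above: "transp above"
  using above_trans by (auto intro: transpI)

lemma tableau_Cons:
  "tableau (r # rs) \<longleftrightarrow> sorted_wrt (<) r \<and> (\<forall>s\<in>set rs. above r s) \<and> tableau rs"
  by (auto simp: tableau_def)

lemma tableau_Cons_Cons:
  "tableau (r # s # rs) \<longleftrightarrow> sorted_wrt (<) r \<and> above r s \<and> tableau (s # rs)"
  by (auto simp: tableau_def sorted_wrt2[OF transp_above] simp del: sorted_wrt.simps(2))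

lemma tableau_filter:
  assumes "tableau T" shows "tableau (filter p T)"
  using assms by (auto simp: tableau_def sorted_wrt_filter)

lemma tableau_row_less:
  assumes "tableau T" "i < length T" "j < j'" "j' < length (T ! i)"
  shows "T ! i ! j < T ! i ! j'"
  using assms unfolding tableau_def by (metis nth_mem sorted_wrt_nth_less)

lemma tableau_above:
  assumes "tableau T" "i < i'" "i' < length T"
  shows "above (T ! i) (T ! i')"
  using assms unfolding tableau_def by (metis sorted_wrt_nth_less)

lemma tableau_cell_less:
  assumes "tableau T" "i' < length T" "j' < length (T ! i')" "i \<le> i'" "j \<le> j'" "(i, j) \<noteq> (i', j')"
  shows "T ! i ! j < T ! i' ! j'"
proof (cases "i = i'")
  case True
  then show ?thesis using assms by (auto intro: tableau_row_less)
next
  case False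
  then have ab: "above (T ! i) (T ! i')" using assms by (auto intro: tableau_above)
  then have col: "T ! i ! j' < T ! i' ! j'" using assms(3) by (auto simp: above_def)
  show ?thesis
  proof (cases "j = j'")
    case True then show ?thesis using col by simp
  next
    case False
    have "T ! i ! j < T ! i ! j'"
      using ab False assms by (intro tableau_row_less) (auto simp: above_def)
    then show ?thesis using col by simp
  qed
qed

lemma tableau_head_less:
  assumes "tableau (r # rs)" "v \<in> set (concat rs)"
  shows "r ! 0 < v"
proof -
  obtain s i where s: "s \<in> set rs" "i < length s" "v = s ! i"
    using assms(2) by (auto simp: in_set_conv_nth)
  then obtain a where a: "a < length rs" "s = rs ! a" by (auto simp: in_set_conv_nth)
  have "(r # rs) ! 0 ! 0 < (r # rs) ! Suc a ! i"
    by (rule tableau_cell_less[OF assms(1)]) (use s a in auto)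
  then show ?thesis using s a by simp
qed

text \<open>
  The length of column \<open>j\<close>, that is, the part \<open>j + 1\<close> of the conjugate partition.
\<close>

definition height :: "nat list \<Rightarrow> nat \<Rightarrow> nat" where
  "height \<mu> j = length (filter (\<lambda>l. j < l) \<mu>)"

lemma less_height_iff:
  assumes "sorted_wrt (\<ge>) \<mu>"
  shows "i < height \<mu> j \<longleftrightarrow> i < length \<mu> \<and> j < \<mu> ! i"
  using assms
proof (induction \<mu> arbitrary: i)
  case Nil
  then show ?case by (simp add: height_def)
next
  case (Cons l \<mu>)
  have IH: "i < height \<mu> j \<longleftrightarrow> i < length \<mu> \<and> j < \<mu> ! i" for i
    using Cons by simp
  show ?case
  proof (cases "j < l")
    case True
    then have "height (l # \<mu>) j = Suc (height \<mu> j)" by (simp add: height_def)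
    then show ?thesis using True IH by (cases i) auto
  next
    case False
    then have small: "\<forall>x\<in>set \<mu>. \<not> j < x" using Cons.prems by force
    then have "height (l # \<mu>) j = 0" using False by (simp add: height_def)
    moreover have "\<not> j < (l # \<mu>) ! i" if "i < Suc (length \<mu>)"
      using that False small by (cases i) auto
    ultimately show ?thesis by auto
  qed
qed

lemma length_transpose_sorted_wrt:
  assumes "sorted_wrt (\<ge>) (map length T)"
  shows "length (List.transpose T) = (if T = [] then 0 else length (T ! 0))"
  using assms length_transpose_sorted[of T] by (simp add: sorted_wrt_rev)

lemma transpose_nth_eq:
  assumes "sorted_wrt (\<ge>) (map length T)" "j < length (List.transpose T)"
  shows "List.transpose T ! j = map (\<lambda>i. T ! i ! j) [0..<height (map length T) j]"
proof (rule nth_equalityI)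
  have sorted: "sorted (rev (map length T))" using assms by (simp add: sorted_wrt_rev)
  show len: "length (List.transpose T ! j) = length (map (\<lambda>i. T ! i ! j) [0..<height (map length T) j])"
    using assms(2) by (simp add: nth_transpose height_def filter_map o_def)
  fix i assume "i < length (List.transpose T ! j)"
  then have "i < height (map length T) j" using len by simp
  moreover then have "List.transpose T ! j ! i = T ! i ! j"
    by (intro nth_nth_transpose_sorted[OF sorted assms(2)]) (simp add: height_def filter_map o_def)
  ultimately show "List.transpose T ! j ! i = map (\<lambda>i. T ! i ! j) [0..<height (map length T) j] ! i"
    by simp
qed

text \<open>
  The entries up to \<open>m\<close> of an increasing row form an initial segment.
\<close>

lemma sorted_filter_le_length:
  assumes "sorted_wrt (<) r"
  shows "i < length (filter (\<lambda>x. x \<le> (m::nat)) r) \<longleftrightarrow> i < length r \<and> r ! i \<le> m"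
  using assms
proof (induction r arbitrary: i)
  case (Cons a r)
  show ?case
  proof (cases "a \<le> m")
    case True
    then show ?thesis using Cons by (cases i) auto
  next
    case False
    then have "\<forall>x\<in>set r. \<not> x \<le> m" using Cons.prems by force
    then have "filter (\<lambda>x. x \<le> m) (a # r) = []" using False by (simp add: filter_empty_conv)
    moreover have "\<not> (a # r) ! i \<le> m" if "i < Suc (length r)"
      using that False \<open>\<forall>x\<in>set r. \<not> x \<le> m\<close> by (cases i) auto
    ultimately show ?thesis by (metis length_Cons list.size(3) not_less0)
  qed
qed simp

lemma SYT_iff:
  assumes "\<mu> \<in> partitions n"
  shows "T \<in> SYT \<mu> \<longleftrightarrow>
    map length T = \<mu> \<and> tableau T \<and> distinct (concat T) \<and> set (concat T) = {1..n}"
proof -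
  have n: "sum_list \<mu> = n" and sorted: "sorted_wrt (\<ge>) \<mu>"
    using assms by (auto simp: partitions_def)
  have "(\<forall>c\<in>set (List.transpose T). sorted_wrt (<) c) \<longleftrightarrow> sorted_wrt above T"
    if sh: "map length T = \<mu>"
  proof -
    have sT: "sorted_wrt (\<ge>) (map length T)" using sorted sh by simp
    have hl: "i < height \<mu> j \<longleftrightarrow> i < length T \<and> j < length (T ! i)" for i j
      using less_height_iff[OF sorted, of i j] sh by auto
    have col: "List.transpose T ! j = map (\<lambda>i. T ! i ! j) [0..<height \<mu> j]"
      if "j < length (List.transpose T)" for j
      using transpose_nth_eq[OF sT that] sh by simp
    have lt: "j < length (List.transpose T)" if "i < length T" "j < length (T ! i)" for i j
    proof -
      have "0 < height \<mu> j" using hl that by (metis not_gr_zero not_less0)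
      then have "T \<noteq> []" "j < length (T ! 0)" using hl[of 0 j] by auto
      then show ?thesis using length_transpose_sorted_wrt[OF sT] by simp
    qed
    show ?thesis
    proof
      assume L: "\<forall>c\<in>set (List.transpose T). sorted_wrt (<) c"
      show "sorted_wrt above T"
        unfolding sorted_wrt_iff_nth_less above_def
      proof (intro allI impI conjI)
        fix i i' assume i: "i < i'" "i' < length T"
        have "\<mu> ! i' \<le> \<mu> ! i"
          using sorted i sh by (metis length_map sorted_wrt_nth_less)
        then show "length (T ! i') \<le> length (T ! i)" using i sh by auto
        fix j assume j: "j < length (T ! i')"
        have s: "sorted_wrt (<) (List.transpose T ! j)" using L lt[OF i(2) j] by simp
        have "i' < height \<mu> j" using hl i j by simp
        then show "T ! i ! j < T ! i' ! j"
          using sorted_wrt_nth_less[OF s i(1)] i by (simp add: col[OF lt[OF i(2) j]])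
      qed
    next
      assume R: "sorted_wrt above T"
      show "\<forall>c\<in>set (List.transpose T). sorted_wrt (<) c"
      proof
        fix c assume "c \<in> set (List.transpose T)"
        then obtain j where j: "j < length (List.transpose T)" "c = List.transpose T ! j"
          by (metis in_set_conv_nth)
        show "sorted_wrt (<) c"
          unfolding j(2) col[OF j(1)] sorted_wrt_iff_nth_less
        proof (intro allI impI)
          fix i i' assume "i < i'" "i' < length (map (\<lambda>i. T ! i ! j) [0..<height \<mu> j])"
          then show "map (\<lambda>i. T ! i ! j) [0..<height \<mu> j] ! i < map (\<lambda>i. T ! i ! j) [0..<height \<mu> j] ! i'"
            using sorted_wrt_nth_less[OF R] hl[of i' j] by (auto simp: above_def)
        qed
      qed
    qed
  qed
  then show ?thesis using n by (auto simp: SYT_def tableau_def)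
qed

lemma reverse_columns_shape:
  assumes "sorted_wrt (\<ge>) (map length T)" "[] \<notin> set T"
  shows "map length (reverse_columns T) = map length T"
    and reverse_columns_nth: "i < length T \<Longrightarrow> j < length (T ! i) \<Longrightarrow>
      reverse_columns T ! i ! j = T ! (height (map length T) j - 1 - i) ! j"
proof -
  define h where "h = height (map length T)"
  define C where "C = map rev (List.transpose T)"
  have hl: "i < h j \<longleftrightarrow> i < length T \<and> j < length (T ! i)" for i j
    using less_height_iff[OF assms(1), of i j] by (auto simp: h_def)
  have lenC: "length C = (if T = [] then 0 else length (T ! 0))"
    unfolding C_def using length_transpose_sorted_wrt[OF assms(1)] by simp
  have C: "C ! j = rev (map (\<lambda>i. T ! i ! j) [0..<h j])" if "j < length C" for j
    using that transpose_nth_eq[OF assms(1), of j] by (simp add: C_def h_def)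
  have sC: "sorted_wrt (\<ge>) (map length C)"
    unfolding C_def using sorted_transpose[of T] by (simp add: sorted_wrt_rev o_def)
  have h0: "h 0 = length T"
    using hl[of _ 0] assms(2) by (metis length_greater_0_conv linorder_neqE_nat nth_mem order_less_irrefl)
  have lt: "j < length C" if "j < length (T ! i)" "i < length T" for i j
  proof -
    have "0 < h j" using hl that by (metis not_gr_zero not_less0)
    then show ?thesis using hl[of 0 j] lenC by auto
  qed
  have lenR: "length (reverse_columns T) = length T"
  proof (cases "T = []")
    case True then show ?thesis by (simp add: reverse_columns_def)
  next
    case False
    then have "0 < length C" using lenC assms(2) by (metis length_greater_0_conv nth_mem)
    then show ?thesis
      using length_transpose_sorted_wrt[OF sC] C[of 0] h0 by (auto simp: reverse_columns_def C_def)
  qed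
  have hC: "height (map length C) i = length (T ! i)" if "i < length T" for i
  proof -
    have "j < height (map length C) i \<longleftrightarrow> j < length (T ! i)" for j
      using less_height_iff[OF sC, of j i] lt[of j i] C[of j] hl[of i j] that by auto
    then show ?thesis by (metis linorder_neqE_nat order_less_irrefl)
  qed
  have R: "reverse_columns T ! i = map (\<lambda>j. C ! j ! i) [0..<length (T ! i)]" if "i < length T" for i
    using transpose_nth_eq[OF sC, of i] that lenR hC[OF that] by (simp add: reverse_columns_def C_def)
  show "map length (reverse_columns T) = map length T"
    by (rule nth_equalityI) (use lenR R in auto)
  assume ij: "i < length T" "j < length (T ! i)"
  then have "i < h j" using hl by simp
  then have "rev (map (\<lambda>i. T ! i ! j) [0..<h j]) ! i = T ! (h j - 1 - i) ! j"
    by (simp add: rev_nth)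
  then show "reverse_columns T ! i ! j = T ! (height (map length T) j - 1 - i) ! j"
    using R[OF ij(1)] C[OF lt[OF ij(2,1)]] ij(2) by (simp add: h_def)
qed

section \<open>Row insertion and injectivity of the correspondence\<close>

definition add_box :: "nat \<Rightarrow> nat list \<Rightarrow> nat list" where
  "add_box k ls = (if k < length ls then ls[k := Suc (ls ! k)] else ls @ [1])"

lemma add_box_simps [simp]:
  "add_box k [] = [1]"
  "add_box 0 (l # ls) = Suc l # ls"
  "add_box (Suc k) (l # ls) = l # add_box k ls"
  by (auto simp: add_box_def)

lemma add_box_inject:
  "add_box k as = add_box k bs \<Longrightarrow> k \<le> length as \<Longrightarrow> k \<le> length bs \<Longrightarrow> 0 \<notin> set as \<Longrightarrow> 0 \<notin> set bs
    \<Longrightarrow> as = bs"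
proof (induction as arbitrary: k bs)
  case Nil
  then show ?case by (cases bs) auto
next
  case (Cons a as)
  then show ?case by (cases bs; cases k) auto
qed

lemma add_cell_simps [simp]:
  "add_cell k m [] = [[m]]"
  "add_cell 0 m (r # rs) = (r @ [m]) # rs"
  "add_cell (Suc k) m (r # rs) = r # add_cell k m rs"
  by (auto simp: add_cell_def)

lemma map_length_add_cell: "map length (add_cell k m Q) = add_box k (map length Q)"
  by (auto simp: add_cell_def add_box_def map_update)

lemma set_add_cell: "set (concat (add_cell k m Q)) = insert m (set (concat Q))"
proof (induction Q arbitrary: k)
  case (Cons r Q)
  then show ?case by (cases k) auto
qed simp

lemma Nil_notin_add_cell: "[] \<notin> set Q \<Longrightarrow> [] \<notin> set (add_cell k m Q)"
proof (induction Q arbitrary: k)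
  case (Cons r Q)
  then show ?case by (cases k) auto
qed simp

lemma add_cell_inject:
  assumes "add_cell k m Q = add_cell k' m Q'" "k \<le> length Q" "k' \<le> length Q'"
    "m \<notin> set (concat Q)" "m \<notin> set (concat Q')" "[] \<notin> set Q" "[] \<notin> set Q'"
  shows "k = k' \<and> Q = Q'"
  using assms
proof (induction Q arbitrary: k k' Q')
  case Nil
  then show ?case by (cases Q'; cases k') auto
next
  case (Cons r Q)
  note IH = Cons.IH and prems0 = Cons.prems
  show ?case
  proof (cases Q')
    case Nil
    then show ?thesis using prems0 by (cases k) auto
  next
    case (Cons r' Q2)
    note prems = prems0[unfolded Cons]
    show ?thesis
    proof (cases k)
      case 0
      then show ?thesis using prems Cons by (cases k') auto
    next
      case (Suc l)
      then obtain l' where l': "k' = Suc l'" using prems by (cases k') auto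
      then have "l = l' \<and> Q = Q2"
        using prems Suc by (intro IH) auto
      then show ?thesis using prems Suc l' Cons by auto
    qed
  qed
qed

lemma bump_split:
  "bump x r = (r', None) \<Longrightarrow> r' = r @ [x] \<and> (\<forall>a\<in>set r. a \<le> x)"
  "bump x r = (r', Some y) \<Longrightarrow>
    \<exists>as bs. r = as @ y # bs \<and> r' = as @ x # bs \<and> (\<forall>a\<in>set as. a \<le> x) \<and> x < y"
proof (induction x r arbitrary: r' rule: bump.induct)
  case (2 x z zs)
  { case 1 show ?case using 1 2 by (auto split: if_splits prod.splits) }
  { case 2
    show ?case
    proof (cases "x < z")
      case True
      then show ?thesis using 2 by (intro exI[of _ "[]"] exI[of _ zs]) auto
    next
      case False
      then obtain r'' where r'': "bump x zs = (r'', Some y)" "r' = z # r''"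
        using 2 by (auto split: prod.splits)
      then obtain as bs where "zs = as @ y # bs" "r'' = as @ x # bs" "\<forall>a\<in>set as. a \<le> x" "x < y"
        using "2.IH"(2)[OF False] by blast
      then show ?thesis using r'' False by (intro exI[of _ "z # as"] exI[of _ bs]) auto
    qed }
qed auto

lemma bump_append:
  "\<forall>a\<in>set r. a \<le> x \<Longrightarrow> bump x r = (r @ [x], None)"
  by (induction r) auto

lemma bump_replace:
  "\<forall>a\<in>set as. a \<le> x \<Longrightarrow> x < y \<Longrightarrow> bump x (as @ y # bs) = (as @ x # bs, Some y)"
  by (induction as) auto

text \<open>
  The recursion of \<open>row_insert\<close> with \<open>bump\<close> eliminated: inductions over the rows can work with
  the split \<open>as @ y # bs\<close> at the bumped entry instead of a second induction inside the row.
\<close>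

lemma row_insert_cases [consumes 1, case_names empty append bump]:
  assumes "row_insert x T = (P, k)"
  obtains "T = []" "P = [[x]]" "k = 0"
  | r rs where "T = r # rs" "P = (r @ [x]) # rs" "k = 0" "\<forall>a\<in>set r. a \<le> x"
  | as y bs rs P' k' where "T = (as @ y # bs) # rs" "P = (as @ x # bs) # P'" "k = Suc k'"
      "\<forall>a\<in>set as. a \<le> x" "x < y" "row_insert y rs = (P', k')"
proof (cases T)
  case Nil
  then show ?thesis using assms that by auto
next
  case (Cons r rs)
  obtain r' b where b: "bump x r = (r', b)" by fastforce
  show ?thesis
  proof (cases b)
    case None
    then show ?thesis using assms Cons b bump_split(1)[of x r r'] that(2)[of r rs] by auto
  next
    case (Some y)
    then obtain P' k' where "row_insert y rs = (P', k')" "P = r' # P'" "k = Suc k'"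
      using assms Cons b by (auto split: prod.splits)
    then show ?thesis using bump_split(2)[of x r r' y] b Some Cons that(3) by blast
  qed
qed

lemma row_insert_mset:
  "row_insert x T = (P, k) \<Longrightarrow> mset (concat P) = add_mset x (mset (concat T))"
proof (induction T arbitrary: x P k)
  case (Cons r rs)
  from Cons.prems show ?case
    by (cases rule: row_insert_cases) (auto dest: Cons.IH)
qed auto

lemma row_insert_shape:
  "row_insert x T = (P, k) \<Longrightarrow> map length P = add_box k (map length T) \<and> k \<le> length T"
proof (induction T arbitrary: x P k)
  case (Cons r rs)
  from Cons.prems show ?case
    by (cases rule: row_insert_cases) (auto dest: Cons.IH)
qed auto

lemma row_insert_Nil_notin:
  "row_insert x T = (P, k) \<Longrightarrow> [] \<notin> set T \<Longrightarrow> [] \<notin> set P"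
proof (induction T arbitrary: x P k)
  case (Cons r rs)
  from Cons.prems(1) show ?case
    by (cases rule: row_insert_cases) (use Cons in auto)
qed auto

lemma row_insert_sorted:
  "row_insert x T = (P, k) \<Longrightarrow> \<forall>r\<in>set T. sorted r \<Longrightarrow> \<forall>r\<in>set P. sorted r"
proof (induction T arbitrary: x P k)
  case (Cons r rs)
  from Cons.prems(1) show ?case
  proof (cases rule: row_insert_cases)
    case (bump as y bs rs P' k')
    then have "\<forall>r\<in>set P'. sorted r" using Cons by auto
    moreover have "sorted (as @ x # bs)"
      using bump Cons.prems(2) by (auto simp: sorted_append less_imp_le order.trans[OF less_imp_le])
    ultimately show ?thesis using bump by auto
  qed (use Cons in \<open>auto simp: sorted_append\<close>)
qed auto

text \<open>
  Undoing a bump: the bumped entry \<open>y\<close> must return to the position of the last entry smaller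
  than \<open>y\<close>, so the row before the bump and the inserted entry are determined.
\<close>

lemma replaced_entry_unique:
  assumes "as @ x # bs = as' @ x' # (bs' :: nat list)"
    "x < y" "x' < y" "sorted (as @ y # bs)" "sorted (as' @ y # bs')"
  shows "as = as' \<and> x = x' \<and> bs = bs'"
  using assms
proof (induction as arbitrary: as')
  case Nil
  then show ?case by (cases as') auto
next
  case (Cons a as)
  then show ?case by (cases as') auto
qed

text \<open>
  Insertion can be undone once the row of the new box is known. The induction goes through the
  bumped entries: those of the two insertions agree from the second row on, and then so do the first rows.
\<close>

lemma row_insert_inject:
  assumes "row_insert x T = (P, k)" "row_insert x' T' = (P, k)"
    "\<forall>r\<in>set T. sorted r" "\<forall>r\<in>set T'. sorted r" "[] \<notin> set T" "[] \<notin> set T'"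
  shows "x = x' \<and> T = T'"
  using assms
proof (induction T arbitrary: x x' P k T')
  case Nil
  from Nil.prems(2) show ?case by (cases rule: row_insert_cases) (use Nil.prems(1,6) in auto)
next
  case (Cons r rs)
  from Cons.prems(1) show ?case
  proof (cases rule: row_insert_cases)
    case (append r2 rs2)
    from Cons.prems(2) show ?thesis by (cases rule: row_insert_cases) (use append Cons.prems(5,6) in auto)
  next
    case 1: (bump as y bs rs1 P1 k1)
    from Cons.prems(2) show ?thesis
    proof (cases rule: row_insert_cases)
      case 2: (bump as' y' bs' rs2 P2 k2)
      have "y = y' \<and> rs = rs2"
        proof (rule Cons.IH)
        show "row_insert y rs = (P1, k1)" "row_insert y' rs2 = (P1, k1)"
          using 1(1,2,3,6) 2(2,3,6) by auto
      qed (use 1(1) 2(1) Cons.prems(3-6) in auto)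
      moreover then have "as = as' \<and> x = x' \<and> bs = bs'"
        by (intro replaced_entry_unique[of as x bs as' x' bs' y])
          (use 1(1,2,5) 2(1,2,5) Cons.prems(3,4) in auto)
      ultimately show ?thesis using 1(1) 2(1) by simp
    qed (use 1 in auto)
  qed auto
qed

lemma RS_Suc_cases:
  assumes "RS (Suc n) \<sigma> = (P, Q)"
  obtains P' Q' k where "RS n \<sigma> = (P', Q')" "row_insert (\<sigma> (Suc n)) P' = (P, k)"
    "Q = add_cell k (Suc n) Q'"
  using assms by (auto split: prod.splits)

lemma RS_invariants:
  "RS n \<sigma> = (P, Q) \<Longrightarrow>
    (\<forall>r\<in>set P. sorted r) \<and> [] \<notin> set P \<and> [] \<notin> set Q \<and> map length P = map length Q
    \<and> set (concat Q) = {1..n} \<and> mset (concat P) = image_mset \<sigma> (mset_set {1..n})"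
proof (induction n arbitrary: P Q)
  case (Suc n)
  from Suc.prems obtain P' Q' k where *: "RS n \<sigma> = (P', Q')" "row_insert (\<sigma> (Suc n)) P' = (P, k)"
    "Q = add_cell k (Suc n) Q'" by (rule RS_Suc_cases)
  note IH = Suc.IH[OF *(1)]
  have "mset_set {1..Suc n} = add_mset (Suc n) (mset_set {1..n})"
    by (simp add: atLeastAtMostSuc_conv)
  then show ?case
    using IH row_insert_sorted[OF *(2)] row_insert_Nil_notin[OF *(2)] row_insert_shape[OF *(2)]
      row_insert_mset[OF *(2)] *(3) set_add_cell[of k "Suc n" Q']
    by (auto simp: map_length_add_cell Nil_notin_add_cell atLeastAtMostSuc_conv)
qed auto

text \<open>
  Injectivity for words with possible repetitions: the recording tableau names the row of the
  last box, so the last insertion can be undone. Two words with the same pair of tableaux therefore agree,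
  even if one of them is not known to be a permutation.
\<close>

lemma RS_inject:
  "RS n \<sigma> = RS n \<tau> \<Longrightarrow> i \<in> {1..n} \<Longrightarrow> \<sigma> i = \<tau> i"
proof (induction n)
  case (Suc n)
  obtain P Q where PQ: "RS (Suc n) \<sigma> = (P, Q)" by fastforce
  obtain P1 Q1 k1 where 1: "RS n \<sigma> = (P1, Q1)" "row_insert (\<sigma> (Suc n)) P1 = (P, k1)"
    "Q = add_cell k1 (Suc n) Q1" using PQ by (rule RS_Suc_cases)
  obtain P2 Q2 k2 where 2: "RS n \<tau> = (P2, Q2)" "row_insert (\<tau> (Suc n)) P2 = (P, k2)"
    "Q = add_cell k2 (Suc n) Q2" using PQ Suc.prems(1) by (metis RS_Suc_cases)
  note inv1 = RS_invariants[OF 1(1)] and inv2 = RS_invariants[OF 2(1)]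
  have len: "k1 \<le> length Q1" "k2 \<le> length Q2"
    using row_insert_shape[OF 1(2)] row_insert_shape[OF 2(2)] inv1 inv2 by (metis length_map)+
  have "Suc n \<notin> set (concat Q1)" "Suc n \<notin> set (concat Q2)" using inv1 inv2 by (metis atLeastAtMost_iff not_less_eq_eq order_refl)+
  then have kQ: "k1 = k2 \<and> Q1 = Q2"
    using add_cell_inject[of k1 "Suc n" Q1 k2 Q2] 1(3) 2(3) len inv1 inv2 by metis
  have "\<sigma> (Suc n) = \<tau> (Suc n) \<and> P1 = P2"
    by (rule row_insert_inject[of _ P1 P k1 _ P2]) (use 1(2) 2(2) kQ inv1 inv2 in auto)
  then show ?case using Suc 1(1) 2(1) kQ by (cases "i = Suc n") auto
qed simp

lemma RS_cong: "(\<And>i. i \<in> {1..n} \<Longrightarrow> \<sigma> i = \<tau> i) \<Longrightarrow> RS n \<sigma> = RS n \<tau>"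
  by (induction n) (auto split: prod.splits)

section \<open>Reverse insertion and surjectivity of the correspondence\<close>

text \<open>
  Reverse insertion keeps columns increasing. The entry \<open>y\<close> leaves column \<open>c\<close> of the lower row
  and enters the upper row in the last possible column \<open>d\<close>. Since \<open>y\<close> is below a smaller entry in
  column \<open>c\<close>, the path moves weakly to the right, \<open>c \<le> d\<close>; to the right of \<open>c\<close> the lower row exceeds \<open>y\<close>,
  and in column \<open>c\<close> itself \<open>y\<close> has been replaced by something larger or removed.
\<close>

lemma above_replace:
  assumes "above r s" "sorted_wrt (<) s" "c < length s" "s ! c = y"
    and d: "\<And>i. i < length r \<Longrightarrow> r ! i < y \<Longrightarrow> i \<le> d"
    and s': "length s' \<le> length s" "\<And>i. i < length s' \<Longrightarrow> i \<noteq> c \<Longrightarrow> s' ! i = s ! i"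
      "c < length s' \<Longrightarrow> y < s' ! c"
  shows "above (r[d := y]) s'"
  unfolding above_def
proof (intro conjI allI impI)
  have rs: "length s \<le> length r" "\<And>i. i < length s \<Longrightarrow> r ! i < s ! i"
    using assms(1) by (auto simp: above_def)
  show "length s' \<le> length (r[d := y])" using rs s' by simp
  fix i assume i: "i < length s'"
  have cd: "c \<le> d" using d[of c] rs assms(3,4) by auto
  have "r ! i < s' ! i"
  proof (cases "i = c")
    case True
    then show ?thesis using s'(3) i rs(2)[of c] assms(3,4) by auto
  next
    case False
    then show ?thesis using s'(1,2) i rs(2) by auto
  qed
  moreover have "y < s' ! d" if "i = d"
  proof (cases "d = c")
    case True
    then show ?thesis using s'(3) i that by simp
  next
    case False
    then have "s ! c < s ! d"
      by (intro sorted_wrt_nth_less[OF assms(2)]) (use cd that i s'(1) in auto)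
    then show ?thesis using False s'(2) i that assms(4) by simp
  qed
  ultimately show "r[d := y] ! i < s' ! i"
    using i s'(1) rs(1) by (cases "i = d") auto
qed

text \<open>
  Everything after the last entry smaller than \<open>y\<close> exceeds \<open>y\<close>. Replacing that entry by \<open>y\<close>
  therefore keeps the row increasing and makes \<open>y\<close> the leftmost entry that exceeds the replaced one, which
  bumps \<open>y\<close> when it is inserted again.
\<close>

lemma unbump:
  assumes "sorted_wrt (<) r" "a < length r" "r ! a < y" "y \<notin> set r"
  obtains d where "d < length r" "r ! d < y" "\<And>i. i < length r \<Longrightarrow> r ! i < y \<Longrightarrow> i \<le> d"
    "sorted_wrt (<) (r[d := y])" "bump (r ! d) (r[d := y]) = (r, Some y)"
proof -
  define D where "D = {i. i < length r \<and> r ! i < y}"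
  define d where "d = Max D"
  have D: "finite D" "D \<noteq> {}" using assms by (auto simp: D_def)
  have d: "d < length r" "r ! d < y" using Max_in[OF D] by (auto simp: d_def D_def)
  have max: "i \<le> d" if "i < length r" "r ! i < y" for i
    using Max_ge[OF D(1), of i] that by (auto simp: d_def D_def)
  have r: "r = take d r @ r ! d # drop (Suc d) r" using d by (simp add: id_take_nth_drop)
  have r': "r[d := y] = take d r @ y # drop (Suc d) r" using d by (simp add: upd_conv_take_nth_drop)
  have big: "y < b" if b: "b \<in> set (drop (Suc d) r)" for b
  proof -
    obtain i where "i < length (drop (Suc d) r)" "drop (Suc d) r ! i = b"
      using b by (metis in_set_conv_nth)
    then have i: "Suc d + i < length r" "b = r ! (Suc d + i)" by auto
    have "\<not> r ! (Suc d + i) < y" "r ! (Suc d + i) \<noteq> y"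
      using max[OF i(1)] assms(4) nth_mem[OF i(1)] by auto
    then show ?thesis using i by simp
  qed
  have "sorted_wrt (<) (take d r @ r ! d # drop (Suc d) r)" using assms(1) r by simp
  then have small: "\<forall>a\<in>set (take d r). a < r ! d" "sorted_wrt (<) (take d r)"
    "sorted_wrt (<) (drop (Suc d) r)" "\<forall>a\<in>set (take d r). \<forall>b\<in>set (drop (Suc d) r). a < b"
    by (auto simp: sorted_wrt_append)
  show ?thesis
  proof (rule that[OF d max])
    show "sorted_wrt (<) (r[d := y])"
      unfolding r' using small big d(2) by (auto simp: sorted_wrt_append)
    have "bump (r ! d) (take d r @ y # drop (Suc d) r) = (take d r @ r ! d # drop (Suc d) r, Some y)"
      by (rule bump_replace) (use small d in auto)
    then show "bump (r ! d) (r[d := y]) = (r, Some y)" using r r' by simp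
  qed
qed

text \<open>
  Starting at a corner, the entry is pushed up row by row. Besides the tableau property the
  induction has to know how the top row changes: only column \<open>c\<close> does, where the entry \<open>x\<close> that leaves is
  replaced by a larger one, or the last cell disappears. This is what \<open>above_replace\<close> needs to attach the next row.
\<close>

lemma uninsert:
  assumes "tableau T" "distinct (concat T)" "k < length T" "T ! k \<noteq> []"
    and "Suc k < length T \<Longrightarrow> length (T ! Suc k) < length (T ! k)"
  shows "\<exists>x U c. row_insert x U = (T, k) \<and> tableau U \<and> length U = length T
    \<and> c < length (hd T) \<and> hd T ! c = x \<and> length (hd U) \<le> length (hd T)
    \<and> (\<forall>i<length (hd U). i \<noteq> c \<longrightarrow> hd U ! i = hd T ! i) \<and> (c < length (hd U) \<longrightarrow> x < hd U ! c)"
  using assms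
proof (induction T arbitrary: k)
  case Nil
  then show ?case by simp
next
  case (Cons r rs)
  have tab: "sorted_wrt (<) r" "\<forall>s\<in>set rs. above r s" "tableau rs"
    using Cons.prems(1) by (auto simp: tableau_Cons)
  show ?case
  proof (cases k)
    case 0
    then have r: "r = butlast r @ [last r]" using Cons.prems(4) by simp
    then have srt: "sorted_wrt (<) (butlast r)" "\<forall>a\<in>set (butlast r). a \<le> last r"
      using tab(1) by (metis sorted_wrt_append, metis sorted_wrt_append less_imp_le list.set_intros(1))
    have "above (butlast r) s" if s: "s \<in> set rs" for s
    proof -
      obtain i where i: "i < length rs" "s = rs ! i" using s by (metis in_set_conv_nth)
      \<comment> \<open>The box is a corner, so all lower rows still fit below the shortened row.\<close>
      have "length s \<le> length (rs ! 0)"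
        using tableau_above[OF tab(3), of 0 i] i by (cases i) (auto simp: above_def)
      then have "length s < length r" using Cons.prems(5) i 0 by (cases rs) auto
      then show ?thesis using tab(2) s by (auto simp: above_def nth_butlast)
    qed
    then have "tableau (butlast r # rs)" using srt tab by (simp add: tableau_Cons)
    moreover have "row_insert (last r) (butlast r # rs) = (r # rs, 0)"
      using bump_append[OF srt(2)] r by simp
    ultimately show ?thesis
      using 0 Cons.prems(4)
      by (intro exI[of _ "last r"] exI[of _ "butlast r # rs"] exI[of _ "length r - 1"])
        (auto simp: nth_butlast last_conv_nth)
  next
    case (Suc l)
    then have l: "l < length rs" using Cons.prems(3) by simp
    obtain y V c where V: "row_insert y V = (rs, l)" "tableau V" "length V = length rs"
      "c < length (hd rs)" "hd rs ! c = y" "length (hd V) \<le> length (hd rs)"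
      "\<And>i. i < length (hd V) \<Longrightarrow> i \<noteq> c \<Longrightarrow> hd V ! i = hd rs ! i" "c < length (hd V) \<Longrightarrow> y < hd V ! c"
      using Cons.IH[of l] Cons.prems Suc tab(3) by auto
    obtain s rs' where rs: "rs = s # rs'" using l by (cases rs) auto
    obtain v V' where VV: "V = v # V'" using V(3) rs by (cases V) auto
    have c: "c < length s" "s ! c = y" and ab: "above r s" "sorted_wrt (<) s"
      using V(4,5) rs tab by (auto simp: tableau_Cons)
    then have "c < length r" "r ! c < y" by (auto simp: above_def)
    moreover have "y \<notin> set r" using Cons.prems(2) rs c by (auto dest: nth_mem)
    ultimately obtain d where d: "d < length r" "r ! d < y"
        "\<And>i. i < length r \<Longrightarrow> r ! i < y \<Longrightarrow> i \<le> d"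
        "sorted_wrt (<) (r[d := y])" "bump (r ! d) (r[d := y]) = (r, Some y)"
      using unbump[OF tab(1), of c y] by blast
    have "above (r[d := y]) v"
      by (rule above_replace[OF ab c d(3)]) (use V rs VV in auto)
    then have "tableau (r[d := y] # V)"
      using V(2) d(4) unfolding VV tableau_Cons_Cons by blast
    moreover have "row_insert (r ! d) (r[d := y] # V) = (r # rs, Suc l)"
      using d(5) V(1) by simp
    ultimately show ?thesis
      using Suc d(1,2) V(3)
      by (intro exI[of _ "r ! d"] exI[of _ "r[d := y] # V"] exI[of _ d]) auto
  qed
qed

text \<open>
  A missing bottom row behaves like an empty one, since inserting \<open>x\<close> produces the new row \<open>[x]\<close> in both cases.
\<close>

lemma row_insert_drop_empty_rows:
  assumes "row_insert x U = (T, k)" "[] \<notin> set T" "tableau U"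
  shows "row_insert x (filter (\<lambda>r. r \<noteq> []) U) = (T, k)"
  using assms
proof (induction U arbitrary: x T k)
  case (Cons r rs)
  from Cons.prems(1) show ?case
  proof (cases rule: row_insert_cases)
    case (append r' rs')
    then have id: "filter (\<lambda>r. r \<noteq> []) rs' = rs'"
      using Cons.prems(2) by (auto simp: filter_id_conv)
    show ?thesis
    proof (cases "r' = []")
      case True
      then have "rs' = []"
        using append Cons.prems(2,3) by (cases rs') (auto simp: tableau_Cons above_def)
      then show ?thesis using append True by simp
    next
      case False
      then show ?thesis using append id by (simp add: bump_append)
    qed
  next
    case (bump as y bs rs1 P1 k1)
    then have "row_insert y (filter (\<lambda>r. r \<noteq> []) rs) = (P1, k1)"
      using Cons.prems(2,3) Cons.IH[of y P1 k1] by (auto simp: tableau_Cons)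
    then show ?thesis using bump by (simp add: bump_replace)
  qed auto
qed auto

text \<open>
  For a standard tableau this is the recording tableau after \<open>m\<close> insertions; rows that become
  empty are dropped because at that time \<open>add_cell\<close> has not started them yet.
\<close>

definition restrict_to :: "nat \<Rightarrow> filling \<Rightarrow> filling" where
  "restrict_to m Q = filter (\<lambda>r. r \<noteq> []) (map (filter (\<lambda>x. x \<le> m)) Q)"

text \<open>
  The cell in row \<open>k\<close> and column \<open>j\<close> is the next free cell of its row, and column \<open>j\<close> is filled
  above it; with \<open>k\<close> equal to the number of rows, it opens a new row.
\<close>

fun addable :: "nat \<Rightarrow> nat \<Rightarrow> nat list \<Rightarrow> bool" where
  "addable 0 j [] \<longleftrightarrow> j = 0"
| "addable 0 j (l # ls) \<longleftrightarrow> l = j"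
| "addable (Suc k) j [] \<longleftrightarrow> False"
| "addable (Suc k) j (l # ls) \<longleftrightarrow> j < l \<and> addable k j ls"

lemma addable_le_length: "addable k j ls \<Longrightarrow> k \<le> length ls"
  by (induction k j ls rule: addable.induct) auto

lemma restrict_to_simps [simp]:
  "restrict_to m [] = []"
  "restrict_to m (r # Q) =
    (if filter (\<lambda>x. x \<le> m) r = [] then restrict_to m Q else filter (\<lambda>x. x \<le> m) r # restrict_to m Q)"
  by (auto simp: restrict_to_def)

lemma set_restrict_to: "set (concat (restrict_to m Q)) = {x \<in> set (concat Q). x \<le> m}"
  by (induction Q) (auto simp: filter_empty_conv)

lemma Nil_notin_restrict_to: "[] \<notin> set (restrict_to m Q)"
  by (auto simp: restrict_to_def)

lemma distinct_restrict_to: "distinct (concat Q) \<Longrightarrow> distinct (concat (restrict_to m Q))"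
proof (induction Q)
  case (Cons r Q)
  then show ?case using set_restrict_to[of m Q] by auto
qed simp

lemma sorted_filter_le_nth:
  assumes "sorted_wrt (<) r" "i < length (filter (\<lambda>x. x \<le> (m::nat)) r)"
  shows "filter (\<lambda>x. x \<le> m) r ! i = r ! i"
  using assms
proof (induction r arbitrary: i)
  case (Cons a r)
  show ?case
  proof (cases "a \<le> m")
    case True
    then show ?thesis using Cons by (cases i) auto
  next
    case False
    then have "filter (\<lambda>x. x \<le> m) (a # r) = []"
      using Cons.prems(1) by (force simp: filter_empty_conv)
    then show ?thesis using Cons.prems(2) by simp
  qed
qed simp

lemma above_filter_le:
  assumes "above r s" "sorted_wrt (<) r" "sorted_wrt (<) s"
  shows "above (filter (\<lambda>x. x \<le> m) r) (filter (\<lambda>x. x \<le> m) s)"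
proof -
  let ?f = "filter (\<lambda>x. x \<le> m)"
  have *: "i < length (?f r) \<and> ?f r ! i < ?f s ! i" if "i < length (?f s)" for i
    using that assms sorted_filter_le_length[of r i m] sorted_filter_le_length[of s i m]
      sorted_filter_le_nth[of r i m] sorted_filter_le_nth[of s i m]
    by (auto simp: above_def)
  then show ?thesis unfolding above_def by (meson less_irrefl not_le)
qed

lemma tableau_restrict_to:
  assumes "tableau Q" shows "tableau (restrict_to m Q)"
  using assms
proof (induction Q)
  case (Cons r Q)
  have "above (filter (\<lambda>x. x \<le> m) r) s" if "s \<in> set (restrict_to m Q)" for s
    using that Cons.prems by (auto simp: restrict_to_def tableau_def intro: above_filter_le)
  then show ?case using Cons by (auto simp: tableau_Cons sorted_wrt_filter)
qed simp

lemma restrict_to_all: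
  assumes "[] \<notin> set Q" "set (concat Q) \<subseteq> {..m}" shows "restrict_to m Q = Q"
proof -
  have "map (filter (\<lambda>x. x \<le> m)) Q = map id Q"
    using assms(2) by (intro map_cong) (auto simp: filter_id_conv)
  then show ?thesis using assms(1) by (auto simp: restrict_to_def filter_id_conv)
qed

lemma filter_le_Suc:
  assumes "sorted_wrt (<) r" "j < length r" "r ! j = Suc m"
  shows "filter (\<lambda>x. x \<le> Suc m) r = filter (\<lambda>x. x \<le> m) r @ [Suc m]"
    "length (filter (\<lambda>x. x \<le> m) r) = j"
  using assms
proof (induction r arbitrary: j)
  case (Cons a r)
  { case 1
    show ?case
    proof (cases j)
      case 0
      then have "filter (\<lambda>x. x \<le> Suc m) r = []" "filter (\<lambda>x. x \<le> m) r = []"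
        using 1 by (force simp: filter_empty_conv)+
      then show ?thesis using 0 1 by simp
    next
      case (Suc i)
      then have "a \<le> m" using 1 nth_mem[of i r] by force
      then show ?thesis using 1 Suc Cons.IH(1)[of i] by simp
    qed }
  { case 2
    show ?case
    proof (cases j)
      case 0
      then have "filter (\<lambda>x. x \<le> m) r = []"
        using 2 by (force simp: filter_empty_conv)
      then show ?thesis using 0 2 by simp
    next
      case (Suc i)
      then have "a \<le> m" using 2 nth_mem[of i r] by force
      then show ?thesis using 2 Suc Cons.IH(2)[of i] by simp
    qed }
qed simp_all

lemma filter_le_Suc_notin:
  "Suc m \<notin> set r \<Longrightarrow> filter (\<lambda>x. x \<le> Suc m) r = filter (\<lambda>x. x \<le> m) r"
  by (intro filter_cong) (auto simp: le_Suc_eq)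

text \<open>
  A standard tableau grows by one cell at a time: the cell of \<open>m + 1\<close> comes after smaller
  entries in its row and in its column, and those form the tableau of the first \<open>m\<close> entries.
\<close>

lemma restrict_to_Suc:
  assumes "tableau Q" "distinct (concat Q)" "k < length Q" "j < length (Q ! k)" "Q ! k ! j = Suc m"
  shows "restrict_to (Suc m) Q = add_cell k (Suc m) (restrict_to m Q)
    \<and> addable k j (map length (restrict_to m Q))"
  using assms
proof (induction Q arbitrary: k)
  case (Cons r Q)
  have r: "sorted_wrt (<) r" and ab: "\<forall>s\<in>set Q. above r s" and Q: "tableau Q" "distinct (concat Q)"
    using Cons.prems(1,2) by (auto simp: tableau_Cons)
  show ?case
  proof (cases k)
    case 0
    then have j: "j < length r" "r ! j = Suc m" using Cons.prems by auto
    then have "Suc m \<in> set r" by (metis nth_mem)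
    then have "Suc m \<notin> set (concat Q)" using Cons.prems(2) by auto
    then have same: "restrict_to (Suc m) Q = restrict_to m Q"
      by (auto simp: restrict_to_def filter_le_Suc_notin cong: map_cong)
    show ?thesis
    proof (cases "filter (\<lambda>x. x \<le> m) r = []")
      case True
      then have "j = 0" using filter_le_Suc(2)[OF r j] by simp
      then have "Suc m < v" if "v \<in> set (concat Q)" for v
        using tableau_head_less[OF Cons.prems(1) that] j by simp
      then have "\<forall>s\<in>set Q. filter (\<lambda>x. x \<le> m) s = []" by (fastforce simp: filter_empty_conv)
      then have "restrict_to m Q = []" by (auto simp: restrict_to_def filter_empty_conv)
      then show ?thesis using True 0 same filter_le_Suc(1)[OF r j] \<open>j = 0\<close> by simp
    next
      case False
      then show ?thesis using 0 same filter_le_Suc[OF r j] by simp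
    qed
  next
    case (Suc l)
    then have l: "l < length Q" "j < length (Q ! l)" "Q ! l ! j = Suc m" using Cons.prems by auto
    then have "above r (Q ! l)" using ab by simp
    then have lt: "j < length r" "r ! j < Suc m" using l by (auto simp: above_def)
    then have len: "j < length (filter (\<lambda>x. x \<le> m) r)" using sorted_filter_le_length[OF r] by simp
    have "Suc m \<in> set (concat Q)" using l by (metis UN_I nth_mem set_concat)
    then have "Suc m \<notin> set r" using Cons.prems(2) by auto
    then have "filter (\<lambda>x. x \<le> Suc m) r = filter (\<lambda>x. x \<le> m) r" by (rule filter_le_Suc_notin)
    then show ?thesis using Cons.IH[OF Q l] Suc len by auto
  qed
qed simp

lemma Nil_notin_shape:
  assumes "map length P = map length Q" "[] \<notin> set P" shows "[] \<notin> set Q"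
proof -
  have "0 \<notin> set (map length P)" using assms(2) by auto
  then have "0 \<notin> set (map length Q)" using assms(1) by simp
  then show ?thesis by force
qed

text \<open>
  The largest entry of \<open>Q\<close> marks a corner; reverse insertion from that corner of \<open>P\<close> yields
  the last letter of the word. The entries of \<open>P\<close> are arbitrary distinct numbers, because removing a letter
  may destroy the standardness of \<open>P\<close> but not that of \<open>Q\<close>.
\<close>

lemma RS_surj:
  assumes "tableau P" "distinct (concat P)" "tableau Q" "distinct (concat Q)"
    "set (concat Q) = {1..n}" "[] \<notin> set P" "map length P = map length Q"
  shows "\<exists>\<sigma>. RS n \<sigma> = (P, Q)"
  using assms
proof (induction n arbitrary: P Q)
  case 0
  have "[] \<notin> set Q" using Nil_notin_shape[OF 0(7,6)] .
  then have "Q = []" using 0(5) by (cases Q) (auto simp: neq_Nil_conv)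
  then show ?case using 0 by simp
next
  case (Suc n)
  have nilQ: "[] \<notin> set Q" using Nil_notin_shape[OF Suc.prems(7,6)] .
  have "Suc n \<in> set (concat Q)" using Suc.prems(5) by simp
  then obtain k j where kj: "k < length Q" "j < length (Q ! k)" "Q ! k ! j = Suc n"
    by (auto simp: in_set_conv_nth)
  define Q' where "Q' = restrict_to n Q"
  have Q: "Q = add_cell k (Suc n) Q'" and add: "addable k j (map length Q')"
    using restrict_to_Suc[OF Suc.prems(3,4) kj] restrict_to_all[OF nilQ, of "Suc n"] Suc.prems(5)
    unfolding Q'_def by auto
  have kP: "k < length P" using kj(1) Suc.prems(7) by (metis length_map)
  have lens: "length (P ! i) = length (Q ! i)" if "i < length Q" for i
    using that Suc.prems(7) by (metis length_map nth_map)
  \<comment> \<open>A cell of \<open>Q\<close> below the largest entry would have to contain a larger one.\<close>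
  have corner: "length (P ! Suc k) < length (P ! k)" if "Suc k < length P"
  proof (rule ccontr)
    assume "\<not> ?thesis"
    moreover have Sk: "Suc k < length Q" using that Suc.prems(7) by (metis length_map)
    ultimately have "j < length (Q ! Suc k)" using lens[OF Sk] lens[OF kj(1)] kj(2) by simp
    moreover then have "Q ! k ! j < Q ! Suc k ! j"
      by (intro tableau_cell_less[OF Suc.prems(3) Sk]) auto
    moreover have "Q ! Suc k ! j \<in> set (concat Q)"
      using Sk \<open>j < length (Q ! Suc k)\<close> by (metis UN_I nth_mem set_concat)
    ultimately show False using kj(3) Suc.prems(5) by (simp del: set_concat)
  qed
  have "P ! k \<noteq> []" using Suc.prems(6) kP by (metis nth_mem)
  then obtain x U where U: "row_insert x U = (P, k)" "tableau U"
    using uninsert[OF Suc.prems(1,2) kP _ corner] by blast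
  define P' where "P' = filter (\<lambda>r. r \<noteq> []) U"
  have ins: "row_insert x P' = (P, k)"
    unfolding P'_def using row_insert_drop_empty_rows[OF U(1) Suc.prems(6) U(2)] .
  have shape: "map length P' = map length Q'"
  proof (rule add_box_inject)
    show "add_box k (map length P') = add_box k (map length Q')"
      using row_insert_shape[OF ins] Suc.prems(7) Q by (metis map_length_add_cell)
    show "k \<le> length (map length P')" using row_insert_shape[OF ins] by simp
    show "k \<le> length (map length Q')" using addable_le_length[OF add] .
    show "0 \<notin> set (map length P')" "0 \<notin> set (map length Q')"
      using Nil_notin_restrict_to[of n Q] by (auto simp: P'_def Q'_def)
  qed
  have "mset (concat P) = add_mset x (mset (concat P'))" using row_insert_mset[OF ins] .
  then have "distinct (concat P')"
    using Suc.prems(2) by (metis distinct.simps(2) mset.simps(2) mset_eq_imp_distinct_iff)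
  moreover have "set (concat Q') = {1..n}"
    unfolding Q'_def set_restrict_to Suc.prems(5) by auto
  ultimately obtain \<sigma> where \<sigma>: "RS n \<sigma> = (P', Q')"
    using Suc.IH[of P' Q'] shape tableau_filter[OF U(2)] tableau_restrict_to[OF Suc.prems(3)]
      distinct_restrict_to[OF Suc.prems(4)] by (auto simp: P'_def Q'_def)
  have "RS n (\<sigma>(Suc n := x)) = RS n \<sigma>" by (rule RS_cong) auto
  then have "RS (Suc n) (\<sigma>(Suc n := x)) = (P, Q)" using \<sigma> ins Q by simp
  then show ?case by blast
qed

text \<open>
  The word found by reverse insertion uses exactly the entries of \<open>P\<close>, so on a pair of standard
  tableaux it is a permutation, once it is continued by the identity outside \<open>{1..n}\<close>. Hence \<open>RS_inv\<close> really
  inverts the correspondence on such pairs.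
\<close>

lemma RS_inv_eq:
  assumes "\<mu> \<in> partitions n" "P \<in> SYT \<mu>" "Q \<in> SYT \<mu>"
  shows "RS_inv n (P, Q) permutes {1..n}" "RS n (RS_inv n (P, Q)) = (P, Q)"
proof -
  have nil: "[] \<notin> set P" using assms(1,2) by (auto simp: SYT_iff partitions_def)
  obtain \<sigma> where \<sigma>: "RS n \<sigma> = (P, Q)"
    using RS_surj[of P Q n] nil assms by (auto simp: SYT_iff)
  have "set_mset (mset (concat P)) = set_mset (image_mset \<sigma> (mset_set {1..n}))"
    using RS_invariants[OF \<sigma>] by simp
  then have "\<sigma> ` {1..n} = {1..n}"
    using assms(1,2) by (simp add: SYT_iff del: set_concat)
  define \<tau> where "\<tau> i = (if i \<in> {1..n} then \<sigma> i else i)" for i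
  have "\<tau> permutes {1..n}"
  proof (rule bij_imp_permutes)
    have "\<tau> ` {1..n} = {1..n}" using \<open>\<sigma> ` {1..n} = {1..n}\<close> by (simp add: \<tau>_def)
    then show "bij_betw \<tau> {1..n} {1..n}" by (simp add: bij_betw_def eq_card_imp_inj_on)
  qed (auto simp: \<tau>_def)
  moreover have "RS n \<tau> = (P, Q)" using RS_cong[of n \<tau> \<sigma>] \<sigma> by (simp add: \<tau>_def)
  ultimately have "(P, Q) \<in> RS n ` {\<sigma>. \<sigma> permutes {1..n}}" by force
  then show "RS_inv n (P, Q) permutes {1..n}" "RS n (RS_inv n (P, Q)) = (P, Q)"
    using inv_into_into[of "(P, Q)" "RS n" "{\<sigma>. \<sigma> permutes {1..n}}"]
      f_inv_into_f[of "(P, Q)" "RS n" "{\<sigma>. \<sigma> permutes {1..n}}"]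
    by (simp_all add: RS_inv_def)
qed

section \<open>Descents and the necessity of admissibility\<close>

text \<open>
  If \<open>v\<close> and \<open>v + 1\<close> both occur, then \<open>v + 1\<close> lies in a strictly lower row: \<open>v\<close> is a descent
  of the tableau. The condition is vacuous while one of the two is missing, so it can serve as an invariant.
\<close>

fun succ_below :: "nat \<Rightarrow> filling \<Rightarrow> bool" where
  "succ_below v [] \<longleftrightarrow> True"
| "succ_below v (r # rs) \<longleftrightarrow> (Suc v \<in> set r \<longrightarrow> v \<notin> set r \<and> v \<notin> set (concat rs)) \<and> succ_below v rs"

lemma succ_below_row: "succ_below v T \<Longrightarrow> r \<in> set T \<Longrightarrow> v \<in> set r \<Longrightarrow> Suc v \<notin> set r"
  by (induction T) auto

text \<open>
  When \<open>v\<close> enters the row of \<open>v + 1\<close>, it displaces precisely \<open>v + 1\<close>, because no other entry fits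
  between them; so \<open>v\<close> never catches up with \<open>v + 1\<close>. The last hypothesis excludes that \<open>v + 1\<close> itself is inserted
  after \<open>v\<close>.
\<close>

lemma row_insert_succ_below:
  assumes "row_insert x T = (P, k)" "succ_below v T" "\<forall>r\<in>set T. sorted r" "distinct (concat P)"
    and "x = Suc v \<Longrightarrow> v \<notin> set (concat T)"
  shows "succ_below v P"
  using assms
proof (induction T arbitrary: x P k)
  case (Cons r rs)
  from Cons.prems(1) show ?case
  proof (cases rule: row_insert_cases)
    case (append r' rs')
    then show ?thesis using Cons.prems by auto
  next
    case (bump as y bs rs' P' k')
    have ins: "row_insert y rs = (P', k')" using bump by simp
    have m: "mset (concat P') = add_mset y (mset (concat rs))" using row_insert_mset[OF ins] .
    then have set: "set (concat P') = insert y (set (concat rs))"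
      by (metis set_mset_add_mset_insert set_mset_mset)
    have dist: "y \<notin> set (as @ x # bs)" "distinct (concat P')"
      using Cons.prems(4) bump(2) set by auto
    have r: "r = as @ y # bs" using bump by simp
    have "succ_below v P'"
    proof (rule Cons.IH[OF ins])
      show "y = Suc v \<Longrightarrow> v \<notin> set (concat rs)" using Cons.prems(2) r by auto
    qed (use Cons.prems dist in auto)
    moreover have "v \<notin> set (as @ x # bs) \<and> v \<notin> set (concat P')" if s: "Suc v \<in> set (as @ x # bs)"
    proof (cases "x = Suc v")
      case True
      then show ?thesis using Cons.prems(5) bump(5) r set by auto
    next
      case False
      then have "Suc v \<in> set r" using s r by auto
      then have v: "v \<notin> set r" "v \<notin> set (concat rs)" using Cons.prems(2) by auto
      have "x \<noteq> v"
      proof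
        assume "x = v"
        have "Suc v \<in> set bs" using s False bump(4) \<open>x = v\<close> by auto
        then have "y \<le> Suc v" using Cons.prems(3) r by (auto simp: sorted_append)
        then have "y = Suc v" using bump(5) \<open>x = v\<close> by simp
        then show False using dist(1) s by simp
      qed
      then show ?thesis using v r set by auto
    qed
    ultimately show ?thesis using bump(2) by simp
  qed auto
qed auto

text \<open>
  The hypothesis on positions says that \<open>v\<close> is inserted when \<open>v + 1\<close> is already present; from then
  on \<open>row_insert_succ_below\<close> keeps \<open>v + 1\<close> below \<open>v\<close>.
\<close>

lemma RS_succ_below:
  assumes "RS n \<sigma> = (P, Q)" "inj_on \<sigma> {1..n}"
    and "\<And>a b. a \<in> {1..n} \<Longrightarrow> b \<in> {1..n} \<Longrightarrow> \<sigma> a = v \<Longrightarrow> \<sigma> b = Suc v \<Longrightarrow> b < a"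
  shows "succ_below v P"
  using assms
proof (induction n arbitrary: P Q)
  case (Suc n)
  obtain P' Q' k where *: "RS n \<sigma> = (P', Q')" "row_insert (\<sigma> (Suc n)) P' = (P, k)"
    using Suc.prems(1) by (rule RS_Suc_cases)
  have inv: "mset (concat P) = image_mset \<sigma> (mset_set {1..Suc n})"
    "mset (concat P') = image_mset \<sigma> (mset_set {1..n})" "\<forall>r\<in>set P'. sorted r"
    using RS_invariants[OF Suc.prems(1)] RS_invariants[OF *(1)] by auto
  have dist: "distinct (concat P)"
  proof (rule card_distinct)
    have "set (concat P) = \<sigma> ` {1..Suc n}"
      using arg_cong[OF inv(1), of set_mset] by (simp del: set_concat)
    then have "card (set (concat P)) = Suc n" using card_image[OF Suc.prems(2)] by simp
    moreover have "length (concat P) = Suc n"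
      using arg_cong[OF inv(1), of size] by (simp del: mset_concat)
    ultimately show "card (set (concat P)) = length (concat P)" by simp
  qed
  have set: "set (concat P') = \<sigma> ` {1..n}"
    using arg_cong[OF inv(2), of set_mset] by (simp del: set_concat)
  have "succ_below v P'"
  proof (rule Suc.IH[OF *(1)])
    show "inj_on \<sigma> {1..n}" using Suc.prems(2) by (rule inj_on_subset) auto
  qed (use Suc.prems(3) in auto)
  moreover have "v \<notin> set (concat P')" if "\<sigma> (Suc n) = Suc v"
    unfolding set using Suc.prems(3)[of _ "Suc n"] that by fastforce
  ultimately show ?case using row_insert_succ_below[OF *(2)] inv(3) dist by blast
qed auto

text \<open>
  For \<open>a = 1\<close> the row superstandard tableau. In a row of length \<open>l\<close> none of the first
  \<open>l - 1\<close> entries is a descent, so it turns every horizontal inequality in \<open>reverse_columns Q\<close> into a statement about descents.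
\<close>

fun consecutive_rows :: "nat \<Rightarrow> nat list \<Rightarrow> filling" where
  "consecutive_rows a [] = []"
| "consecutive_rows a (l # ls) = [a..<a + l] # consecutive_rows (a + l) ls"

lemma map_length_consecutive_rows: "map length (consecutive_rows a ls) = ls"
  by (induction ls arbitrary: a) auto

lemma concat_consecutive_rows: "concat (consecutive_rows a ls) = [a..<a + sum_list ls]"
proof (induction ls arbitrary: a)
  case (Cons l ls)
  then show ?case using upt_add_eq_append[of a "a + l" "sum_list ls"] by (simp add: add.assoc)
qed simp

lemma tableau_consecutive_rows:
  "sorted_wrt (\<ge>) ls \<Longrightarrow> tableau (consecutive_rows a ls)"
proof (induction ls arbitrary: a)
  case (Cons l ls)
  have "above [a..<a + l] s" if s: "s \<in> set (consecutive_rows (a + l) ls)" for s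
    unfolding above_def
  proof (intro conjI allI impI)
    have "length s \<in> set ls"
      using s map_length_consecutive_rows[of "a + l" ls] by (metis image_eqI set_map)
    then have "length s \<le> l" using Cons.prems by simp
    then show "length s \<le> length [a..<a + l]" by simp
    fix i assume i: "i < length s"
    then have "s ! i \<in> set (concat (consecutive_rows (a + l) ls))"
      using s by (metis UN_I nth_mem set_concat)
    then have "a + l \<le> s ! i" unfolding concat_consecutive_rows by simp
    then show "[a..<a + l] ! i < s ! i" using i \<open>length s \<le> l\<close> by simp
  qed
  then show ?case using Cons by (simp add: tableau_Cons)
qed (simp add: tableau_def)

lemma consecutive_rows_nth_Suc:
  "i < length ls \<Longrightarrow> Suc j < ls ! i \<Longrightarrow>
    consecutive_rows a ls ! i ! Suc j = Suc (consecutive_rows a ls ! i ! j)"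
proof (induction ls arbitrary: a i)
  case (Cons l ls)
  then show ?case by (cases i) auto
qed simp

lemma consecutive_rows_SYT:
  assumes "\<mu> \<in> partitions n" shows "consecutive_rows 1 \<mu> \<in> SYT \<mu>"
  using assms
  by (auto simp del: set_concat simp: SYT_iff[OF assms] concat_consecutive_rows map_length_consecutive_rows
      partitions_def tableau_consecutive_rows)

text \<open>
  Testing a single tableau suffices. If \<open>P\<close> is row superstandard and \<open>\<sigma>\<close> carries
  \<open>reverse_columns Q\<close> to \<open>P\<close>, then two horizontal neighbours of \<open>reverse_columns Q\<close> are the positions of \<open>v\<close>
  and \<open>v + 1\<close> in the word \<open>\<sigma>\<close>. As \<open>v\<close> and \<open>v + 1\<close> share a row of \<open>P\<close>, \<open>v\<close> is not a descent, and the positions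
  increase.
\<close>

lemma eq_perm_act_imp_admissible:
  assumes \<mu>: "\<mu> \<in> partitions n" and Q: "Q \<in> SYT \<mu>"
    and all: "\<And>P. P \<in> SYT \<mu> \<Longrightarrow> P = perm_act (RS_inv n (P, Q)) (reverse_columns Q)"
  shows "admissible Q"
proof -
  define P where "P = consecutive_rows 1 \<mu>"
  define R where "R = reverse_columns Q"
  have P: "P \<in> SYT \<mu>" using consecutive_rows_SYT[OF \<mu>] by (simp add: P_def)
  define \<sigma> where "\<sigma> = RS_inv n (P, Q)"
  have \<sigma>: "\<sigma> permutes {1..n}" "RS n \<sigma> = (P, Q)"
    using RS_inv_eq[OF \<mu> P Q] by (auto simp: \<sigma>_def)
  have PR: "P = map (map \<sigma>) R" using all[OF P] by (simp add: \<sigma>_def perm_act_def R_def)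
  have lenP: "map length P = \<mu>" by (simp add: P_def map_length_consecutive_rows)
  have "R ! i ! j < R ! i ! Suc j" if ij: "i < length R" "Suc j < length (R ! i)" for i j
  proof (rule ccontr)
    assume not: "\<not> R ! i ! j < R ! i ! Suc j"
    define v where "v = P ! i ! j"
    have i: "i < length P" "Suc j < length (P ! i)" using PR ij by auto
    have "P ! i ! Suc j = Suc v"
      unfolding v_def P_def using i lenP by (intro consecutive_rows_nth_Suc) auto
    then have \<sigma>v: "\<sigma> (R ! i ! j) = v" "\<sigma> (R ! i ! Suc j) = Suc v"
      using ij PR by (auto simp: v_def)
    have inj: "inj \<sigma>" using \<sigma>(1) by (rule permutes_inj)
    have "succ_below v P"
    proof (rule RS_succ_below[OF \<sigma>(2)])
      show "inj_on \<sigma> {1..n}" using inj by (rule inj_on_subset) simp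
      fix a b assume "\<sigma> a = v" "\<sigma> b = Suc v"
      then have "a = R ! i ! j" "b = R ! i ! Suc j" using injD[OF inj, of a] injD[OF inj, of b] \<sigma>v by simp_all
      moreover have "a \<noteq> b" using \<open>\<sigma> a = v\<close> \<open>\<sigma> b = Suc v\<close> by auto
      ultimately show "b < a" using not by simp
    qed
    moreover have "v \<in> set (P ! i)" "Suc v \<in> set (P ! i)" "P ! i \<in> set P"
      using i nth_mem[of j "P ! i"] nth_mem[of "Suc j" "P ! i"] \<open>P ! i ! Suc j = Suc v\<close>
      by (auto simp: v_def)
    ultimately show False using succ_below_row by blast
  qed
  then have "sorted_wrt (<) (R ! i)" if "i < length R" for i
    using that by (simp add: sorted_wrt_iff_nth_Suc_transp)
  then show ?thesis by (auto simp: admissible_def R_def in_set_conv_nth)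
qed

section \<open>Vertical insertion and the sufficiency of admissibility\<close>

fun fill :: "(nat \<Rightarrow> nat \<Rightarrow> nat) \<Rightarrow> nat list \<Rightarrow> filling" where
  "fill f [] = []"
| "fill f (l # ls) = map (f 0) [0..<l] # fill (\<lambda>i. f (Suc i)) ls"

lemma fill_cong:
  "(\<And>i j. i < length ls \<Longrightarrow> j < ls ! i \<Longrightarrow> f i j = g i j) \<Longrightarrow> fill f ls = fill g ls"
proof (induction ls arbitrary: f g)
  case (Cons l ls)
  have "fill (\<lambda>i. f (Suc i)) ls = fill (\<lambda>i. g (Suc i)) ls"
    by (rule Cons.IH) (use Cons.prems[of "Suc _"] in auto)
  moreover have "map (f 0) [0..<l] = map (g 0) [0..<l]" using Cons.prems[of 0] by simp
  ultimately show ?case by simp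
qed simp

lemma fill_entries: "fill (\<lambda>i j. T ! i ! j) (map length T) = T"
  by (induction T) (simp_all add: map_nth)

text \<open>
  Vertical insertion. If in each row nothing to the left of column \<open>j\<close> exceeds the entry
  coming from above, but the entry of column \<open>j\<close> is larger, then every bump happens in column \<open>j\<close>: the column
  is pushed down by one cell and nothing else moves. Row \<open>r\<close> receives \<open>g r\<close>. Coordinates are total functions, so
  that the effect of the insertion is a change of the function in column \<open>j\<close> plus one more box in the shape.
\<close>

lemma row_insert_fill:
  assumes "addable k j ls" "sorted_wrt (\<ge>) ls"
    and "\<And>r j'. r \<le> k \<Longrightarrow> j' < j \<Longrightarrow> f r j' \<le> g r"
    and "\<And>r. r < k \<Longrightarrow> g r < f r j" and "\<And>r. g (Suc r) = f r j"
  shows "row_insert (g 0) (fill f ls) = (fill (\<lambda>r j'. if j' = j then g r else f r j') (add_box k ls), k)"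
  using assms
proof (induction k j ls arbitrary: f g rule: addable.induct)
  case (2 j l ls)
  then have l: "l = j" by simp
  let ?F = "\<lambda>r j'. if j' = j then g r else f r j'"
  have "map (f 0) [0..<j] = map (?F 0) [0..<j]" by simp
  then have "bump (g 0) (map (f 0) [0..<j]) = (map (?F 0) [0..<Suc j], None)"
    using 2(3)[of 0] by (subst bump_append) auto
  moreover have "fill (\<lambda>i. ?F (Suc i)) ls = fill (\<lambda>i. f (Suc i)) ls"
  proof (rule fill_cong)
    fix i j' assume "i < length ls" "j' < ls ! i"
    moreover then have "ls ! i \<le> j" using 2(2) l by simp
    ultimately show "?F (Suc i) j' = f (Suc i) j'" by simp
  qed
  ultimately show ?case using l by simp
next
  case (4 k j l ls)
  let ?F = "\<lambda>r j'. if j' = j then g r else f r j'"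
  have j: "j < l" and add: "addable k j ls" using 4(2) by auto
  have "[0..<l] = [0..<j] @ j # [Suc j..<l]"
    using j by (metis upt_add_eq_append le_add_diff_inverse less_imp_le upt_conv_Cons zero_le)
  then have f: "map (f 0) [0..<l] = map (f 0) [0..<j] @ f 0 j # map (f 0) [Suc j..<l]"
    and F: "map (?F 0) [0..<l] = map (f 0) [0..<j] @ g 0 # map (f 0) [Suc j..<l]"
    by auto
  have "bump (g 0) (map (f 0) [0..<l]) = (map (?F 0) [0..<l], Some (g (Suc 0)))"
    unfolding f F 4(6)
    by (rule bump_replace) (use 4(4)[of 0] 4(5)[of 0] in auto)
  moreover have "row_insert (g (Suc 0)) (fill (\<lambda>i. f (Suc i)) ls)
      = (fill (\<lambda>i. ?F (Suc i)) (add_box k ls), k)"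
  proof (rule 4(1)[OF add])
    show "sorted_wrt (\<ge>) ls" using 4(3) by simp
    show "f (Suc r) j' \<le> g (Suc r)" if "r \<le> k" "j' < j" for r j' using 4(4) that by blast
    show "g (Suc r) < f (Suc r) j" if "r < k" for r using 4(5) that by blast
    show "g (Suc (Suc r)) = f (Suc r) j" for r by (rule 4(6))
  qed
  ultimately show ?case by simp
qed auto

lemma distinct_concat_cells:
  "distinct (concat Q) \<Longrightarrow> i < length Q \<Longrightarrow> j < length (Q ! i) \<Longrightarrow> i' < length Q \<Longrightarrow> j' < length (Q ! i')
    \<Longrightarrow> Q ! i ! j = Q ! i' ! j' \<Longrightarrow> i = i' \<and> j = j'"
proof (induction Q arbitrary: i i')
  case (Cons r Q)
  have notin: "r ! a \<noteq> Q ! b ! c" if "a < length r" "b < length Q" "c < length (Q ! b)" for a b c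
  proof -
    have "r ! a \<in> set r" "Q ! b ! c \<in> set (concat Q)"
      using that by (auto intro: nth_mem)
    then show ?thesis using Cons.prems(1) by (auto simp del: set_concat)
  qed
  show ?case
  proof (cases i; cases i')
    fix a assume "i = 0" "i' = Suc a"
    then show ?thesis using Cons.prems notin[of j a j'] by simp
  next
    fix a assume "i = Suc a" "i' = 0"
    then show ?thesis using Cons.prems notin[of j' a j] by simp
  qed (use Cons in \<open>auto simp: nth_eq_iff_index_eq\<close>)
qed simp

text \<open>
  The number of cells of column \<open>j\<close> that are not yet filled after \<open>m\<close> insertions. They are the lowest
  cells of the column in \<open>Q\<close>, hence the highest ones in \<open>reverse_columns Q\<close>.
\<close>

definition late :: "filling \<Rightarrow> nat \<Rightarrow> nat \<Rightarrow> nat" where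
  "late Q m j = card {i. i < height (map length Q) j \<and> m < Q ! i ! j}"

lemma tableau_shape_sorted: "tableau T \<Longrightarrow> sorted_wrt (\<ge>) (map length T)"
  unfolding tableau_def sorted_wrt_map
  by (auto elim!: sorted_wrt_mono_rel[rotated] simp: above_def)

lemma tableau_cell_iff:
  "tableau T \<Longrightarrow> i < height (map length T) j \<longleftrightarrow> i < length T \<and> j < length (T ! i)"
  using less_height_iff[OF tableau_shape_sorted, of T i j] by auto

lemma late_eq:
  assumes "tableau Q" "k < height (map length Q) j" "Q ! k ! j = Suc m"
  shows "late Q m j = height (map length Q) j - k" "late Q (Suc m) j = height (map length Q) j - Suc k"
proof -
  let ?h = "height (map length Q) j"
  have h: "i < ?h \<longleftrightarrow> i < length Q \<and> j < length (Q ! i)" for i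
    by (rule tableau_cell_iff[OF assms(1)])
  have lt: "Q ! a ! j < Q ! b ! j" if "a < b" "b < ?h" for a b
    using that h[of b] by (intro tableau_cell_less[OF assms(1)]) auto
  have "m < Q ! i ! j \<longleftrightarrow> k \<le> i" "Suc m < Q ! i ! j \<longleftrightarrow> Suc k \<le> i" if "i < ?h" for i
    using lt[of i k] lt[of k i] that assms(2,3) by (cases i k rule: linorder_cases; simp)+
  then have "{i. i < ?h \<and> m < Q ! i ! j} = {k..<?h}"
    "{i. i < ?h \<and> Suc m < Q ! i ! j} = {Suc k..<?h}"
    by auto
  then show "late Q m j = ?h - k" "late Q (Suc m) j = ?h - Suc k"
    by (simp_all add: late_def)
qed

lemma late_other_column:
  assumes "tableau Q" "distinct (concat Q)" "k < height (map length Q) j" "Q ! k ! j = Suc m" "j' \<noteq> j"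
  shows "late Q (Suc m) j' = late Q m j'"
proof -
  have "Q ! i ! j' \<noteq> Suc m" if "i < height (map length Q) j'" for i
    using distinct_concat_cells[OF assms(2), of i j' k j] that assms
    by (auto simp: tableau_cell_iff)
  then have "Suc m < Q ! i ! j' \<longleftrightarrow> m < Q ! i ! j'" if "i < height (map length Q) j'" for i
    using that by (metis Suc_lessI Suc_lessD)
  then have "{i. i < height (map length Q) j' \<and> Suc m < Q ! i ! j'}
      = {i. i < height (map length Q) j' \<and> m < Q ! i ! j'}"
    by auto
  then show ?thesis by (simp add: late_def)
qed

text \<open>
  This is where admissibility enters. With \<open>s = late Q m j\<close>, the entry \<open>m + 1\<close> is in row \<open>s - 1\<close> (counted
  from 0) of \<open>reverse_columns Q\<close>. Its left neighbour in column \<open>j'\<close> is at most \<open>m\<close>, and columns of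
  \<open>reverse_columns Q\<close> decrease, so all entries of column \<open>j'\<close> larger than \<open>m\<close> are in the first \<open>s - 1\<close> rows.
\<close>

lemma late_less:
  assumes "tableau Q" "[] \<notin> set Q" "admissible Q"
    and "k < height (map length Q) j" "Q ! k ! j = Suc m" "j' < j"
  shows "late Q m j' < late Q m j"
proof -
  let ?h = "height (map length Q)"
  have h: "i < ?h c \<longleftrightarrow> i < length Q \<and> c < length (Q ! i)" for i c
    by (rule tableau_cell_iff[OF assms(1)])
  note R = reverse_columns_shape[OF tableau_shape_sorted[OF assms(1)] assms(2)]
    reverse_columns_nth[OF tableau_shape_sorted[OF assms(1)] assms(2)]
  define s where "s = ?h j - k"
  have s: "0 < s" "s \<le> ?h j" using assms(4) by (auto simp: s_def)
  have hh: "?h j \<le> ?h j'" using h[of "?h j'" j] h[of "?h j'" j'] assms(6) by force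
  have row: "s - 1 < length Q" "j < length (Q ! (s - 1))" using h[of "s - 1" j] s by auto
  have lenR: "length (reverse_columns Q) = length Q" using R(1) by (metis length_map)
  have "length (reverse_columns Q ! (s - 1)) = length (Q ! (s - 1))"
    using R(1) row(1) lenR by (metis nth_map)
  moreover have "sorted_wrt (<) (reverse_columns Q ! (s - 1))"
    using assms(3) row(1) lenR by (simp add: admissible_def)
  ultimately have "reverse_columns Q ! (s - 1) ! j' < reverse_columns Q ! (s - 1) ! j"
    using assms(6) row(2) by (intro sorted_wrt_nth_less) auto
  moreover have "reverse_columns Q ! (s - 1) ! j = Suc m"
    using R(2)[OF row] assms(4,5) by (simp add: s_def)
  moreover have "reverse_columns Q ! (s - 1) ! j' = Q ! (?h j' - s) ! j'"
    using R(2)[of "s - 1" j'] row assms(6) s by simp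
  ultimately have le: "Q ! (?h j' - s) ! j' \<le> m" by simp
  have "{i. i < ?h j' \<and> m < Q ! i ! j'} \<subseteq> {Suc (?h j' - s)..<?h j'}"
  proof safe
    fix i assume i: "i < ?h j'" "m < Q ! i ! j'"
    have "Q ! i ! j' \<le> Q ! (?h j' - s) ! j'" if "i \<le> ?h j' - s"
      using tableau_cell_less[OF assms(1), of "?h j' - s" j' i j'] h[of "?h j' - s" j'] s hh that
      by (cases "i = ?h j' - s") auto
    then show "i \<in> {Suc (?h j' - s)..<?h j'}" using i le by (auto simp: Suc_le_eq not_le[symmetric])
  qed
  then have "late Q m j' \<le> card {Suc (?h j' - s)..<?h j'}"
    unfolding late_def by (intro card_mono) auto
  also have "\<dots> < s" using s hh by simp
  also have "s = late Q m j" using late_eq(1)[OF assms(1,4,5)] by (simp add: s_def)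
  finally show ?thesis .
qed

text \<open>
  The invariant of the insertion process: after \<open>m\<close> steps, column \<open>j\<close> of the insertion tableau consists
  of the entries of column \<open>j\<close> of \<open>P\<close> without its \<open>late Q m j\<close> topmost ones, moved up to the top. Step
  \<open>m + 1\<close> inserts the lowest missing entry of its column. By \<open>late_less\<close> the columns to the left have been
  moved up less, so the entry to the left in the same row is weakly higher in \<open>P\<close> than the entry
  that arrives there and hence smaller: the insertion is vertical.
\<close>

lemma RS_admissible:
  assumes P: "tableau P" and Q: "tableau Q" "distinct (concat Q)" "set (concat Q) = {1..n}" "[] \<notin> set Q"
    and shape: "map length P = map length Q" and adm: "admissible Q"
    and \<sigma>: "\<And>i j. i < length Q \<Longrightarrow> j < length (Q ! i) \<Longrightarrow>
      \<sigma> (Q ! i ! j) = P ! (height (map length Q) j - 1 - i) ! j"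
    and "m \<le> n"
  shows "RS m \<sigma> =
    (fill (\<lambda>r j. P ! (late Q m j + r) ! j) (map length (restrict_to m Q)), restrict_to m Q)"
  using \<open>m \<le> n\<close>
proof (induction m)
  case 0
  have "0 < v" if "r \<in> set Q" "v \<in> set r" for r v
  proof -
    have "v \<in> set (concat Q)" using that by auto
    then show ?thesis using Q(3) by (simp del: set_concat)
  qed
  then have "restrict_to 0 Q = []" by (fastforce simp: restrict_to_def filter_empty_conv)
  then show ?case by simp
next
  case (Suc m)
  let ?h = "height (map length Q)"
  let ?f = "\<lambda>r j. P ! (late Q m j + r) ! j"
  have h: "i < ?h c \<longleftrightarrow> i < length P \<and> c < length (P ! i)" for i c
    using tableau_cell_iff[OF P] shape by simp
  have "Suc m \<in> set (concat Q)" using Q(3) Suc.prems by simp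
  then obtain k j where kj: "k < length Q" "j < length (Q ! k)" "Q ! k ! j = Suc m"
    by (auto simp: in_set_conv_nth)
  have k: "k < ?h j" using kj tableau_cell_iff[OF Q(1)] by simp
  have step: "restrict_to (Suc m) Q = add_cell k (Suc m) (restrict_to m Q)"
    and add: "addable k j (map length (restrict_to m Q))"
    using restrict_to_Suc[OF Q(1,2) kj] by auto
  note late = late_eq[OF Q(1) k kj(3)]
  \<comment> \<open>The entry that arrives in row \<open>r\<close>: column \<open>j\<close> of \<open>P\<close>, cut off one cell higher than before.\<close>
  define g where "g r = P ! (late Q m j - 1 + r) ! j" for r
  have "row_insert (g 0) (fill ?f (map length (restrict_to m Q)))
      = (fill (\<lambda>r j'. if j' = j then g r else ?f r j') (add_box k (map length (restrict_to m Q))), k)"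
  proof (rule row_insert_fill[OF add tableau_shape_sorted[OF tableau_restrict_to[OF Q(1)]]])
    fix r j' assume r: "r \<le> k" "j' < j"
    have "late Q m j' < late Q m j" by (rule late_less[OF Q(1,4) adm k kj(3) r(2)])
    then have "late Q m j' + r \<le> late Q m j - 1 + r" by linarith
    moreover have "late Q m j - 1 + r < ?h j" using r k late(1) by linarith
    then have "late Q m j - 1 + r < length P" "j < length (P ! (late Q m j - 1 + r))"
      using h by blast+
    ultimately have "?f r j' < g r"
      unfolding g_def using r(2) by (intro tableau_cell_less[OF P]) simp_all
    then show "?f r j' \<le> g r" by simp
  next
    fix r assume r: "r < k"
    then have "late Q m j + r < ?h j" "0 < late Q m j" using k late(1) by linarith+
    moreover then have "late Q m j + r < length P" "j < length (P ! (late Q m j + r))"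
      using h by blast+
    ultimately show "g r < ?f r j"
      unfolding g_def by (intro tableau_cell_less[OF P]) simp_all
  next
    fix r
    have "late Q m j - 1 + Suc r = late Q m j + r" using k late(1) by linarith
    then show "g (Suc r) = ?f r j" unfolding g_def by metis
  qed
  moreover have "late Q (Suc m) j = late Q m j - 1" using late by simp
  then have "(\<lambda>r j'. if j' = j then g r else ?f r j') = (\<lambda>r j'. P ! (late Q (Suc m) j' + r) ! j')"
    using late_other_column[OF Q(1,2) k kj(3)] by (auto simp: fun_eq_iff g_def)
  moreover have "g 0 = \<sigma> (Suc m)"
    using \<sigma>[OF kj(1,2)] kj(3) late(1) by (simp add: g_def diff_commute)
  ultimately show ?case
    using Suc step by (simp add: map_length_add_cell)
qed

text \<open>
  The word \<open>\<sigma>\<close> is read off from the wanted equation, entry by entry. At the end of the process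
  \<open>late\<close> vanishes and the invariant says \<open>RS n \<sigma> = (P, Q)\<close>; injectivity identifies \<open>\<sigma>\<close> with the
  inverse image on the letters \<open>{1..n}\<close>, which are the entries of \<open>reverse_columns Q\<close>.
\<close>

lemma admissible_imp_eq_perm_act:
  assumes \<mu>: "\<mu> \<in> partitions n" and "P \<in> SYT \<mu>" "Q \<in> SYT \<mu>" and adm: "admissible Q"
  shows "P = perm_act (RS_inv n (P, Q)) (reverse_columns Q)"
proof -
  have P: "tableau P" "map length P = \<mu>"
    and Q: "tableau Q" "distinct (concat Q)" "set (concat Q) = {1..n}" "map length Q = \<mu>"
    using assms by (auto simp: SYT_iff)
  have nil: "[] \<notin> set Q" using \<mu> Q(4) by (auto simp: partitions_def)
  let ?h = "height \<mu>"
  have h: "i < ?h c \<longleftrightarrow> i < length Q \<and> c < length (Q ! i)" for i c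
    using tableau_cell_iff[OF Q(1)] Q(4) by simp
  define cells where "cells = {(i, j). i < length Q \<and> j < length (Q ! i)}"
  define entry where "entry = (\<lambda>(i, j). Q ! i ! j)"
  define \<sigma> where "\<sigma> v = (case inv_into cells entry v of (i, j) \<Rightarrow> P ! (?h j - 1 - i) ! j)" for v
  have "inj_on entry cells"
    using distinct_concat_cells[OF Q(2)] by (auto simp: inj_on_def entry_def cells_def)
  then have "inv_into cells entry (Q ! i ! j) = (i, j)" if "i < length Q" "j < length (Q ! i)" for i j
    using inv_into_f_f[of entry cells "(i, j)"] that by (simp add: entry_def cells_def)
  then have \<sigma>: "\<sigma> (Q ! i ! j) = P ! (?h j - 1 - i) ! j" if "i < length Q" "j < length (Q ! i)" for i j
    using that by (simp add: \<sigma>_def)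
  have "late Q n j = 0" for j
  proof -
    have "\<not> n < Q ! i ! j" if "i < ?h j" for i
    proof -
      have "Q ! i ! j \<in> set (concat Q)" using that h by (metis UN_I nth_mem set_concat)
      then show ?thesis using Q(3) by (simp del: set_concat)
    qed
    then have "{i. i < ?h j \<and> n < Q ! i ! j} = {}" by blast
    then show ?thesis unfolding late_def Q(4) by simp
  qed
  moreover have "restrict_to n Q = Q" using restrict_to_all[OF nil] Q(3) by auto
  ultimately have "RS n \<sigma> = (P, Q)"
    using RS_admissible[OF P(1) Q(1-3) nil _ adm, of \<sigma> n] \<sigma> P(2) Q(4) fill_entries[of P]
    by simp
  then have \<tau>: "RS_inv n (P, Q) v = \<sigma> v" if "v \<in> {1..n}" for v
    using RS_inject[of n "RS_inv n (P, Q)" \<sigma>] RS_inv_eq(2)[OF \<mu> assms(2,3)] that by simp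
  note R = reverse_columns_shape[OF tableau_shape_sorted[OF Q(1)] nil]
    reverse_columns_nth[OF tableau_shape_sorted[OF Q(1)] nil]
  have len: "length P = length Q" "length (reverse_columns Q) = length Q"
    using P(2) Q(4) R(1) by (metis length_map)+
  have lens: "length (P ! i) = length (Q ! i)" "length (reverse_columns Q ! i) = length (Q ! i)"
    if "i < length Q" for i
    using P(2) Q(4) R(1) that len by (metis nth_map)+
  have "P ! i ! j = RS_inv n (P, Q) (reverse_columns Q ! i ! j)" if ij: "i < length Q" "j < length (Q ! i)" for i j
  proof -
    let ?i = "?h j - 1 - i"
    have i: "i < ?h j" "?i < ?h j" using ij h[of i j] by auto
    then have cell: "?i < length Q" "j < length (Q ! ?i)" using h by auto
    then have "Q ! ?i ! j \<in> {1..n}" using Q(3) by (metis UN_I nth_mem set_concat)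
    then have "RS_inv n (P, Q) (reverse_columns Q ! i ! j) = \<sigma> (Q ! ?i ! j)"
      using R(2)[OF ij] \<tau> Q(4) by simp
    also have "\<dots> = P ! i ! j" using \<sigma>[OF cell] i by simp
    finally show ?thesis by simp
  qed
  then show ?thesis
    unfolding perm_act_def by (intro nth_equalityI) (auto simp: len lens)
qed

theorem proposition3p2:
  fixes n :: nat and \<mu> :: "nat list" and Q :: filling
  assumes "\<mu> \<in> partitions n" and "Q \<in> SYT \<mu>"
  shows "admissible Q \<longleftrightarrow>
    (\<forall>P\<in>SYT \<mu>. P = perm_act (RS_inv n (P, Q)) (reverse_columns Q))"
  using admissible_imp_eq_perm_act eq_perm_act_imp_admissible assms by blast

end
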